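(* For all $n\geq1$, $j_n(\{231,312\})=2^{\lfloor (n-1)/2\rfloor}$.
   Context: A permutation of a finite set $S$ of positive integers is a word in which each element of $S$ appears exactly once; $\mathfrak{S}_n$ is the set of permutations of $\{1,\dots,n\}$. For a permutation $\pi$ and a letter $x$ of $\pi$, $\rho_\pi(x)$ is the maximal consecutive subword of $\pi$ consisting of the letters immediately to the right of $x$ that are all larger than $x$. $\pi$ is Jacobi if $|\rho_\pi(x)|$ is even for all letters $x$. A permutation $\pi$ avoids a pattern $\sigma$ if no subword of $\pi$ has standardization (relative order) $\sigma$. For a set $\Pi$ of patterns, $j_n(\Pi)$ is the number of Jacobi permutations in $\mathfrak{S}_n$ avoiding every pattern in $\Pi$. *)

theory Defs
  imports "HOL-Combinatorics.Multiset_Permutations" "HOL-Library.Sublist"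
begin

text \<open>Permutations of a finite set are words, i.e. the elements of \<^const>\<open>permutations_of_set\<close>.\<close>

definition rho :: "nat list \<Rightarrow> nat \<Rightarrow> nat list" where
  "rho \<pi> x = takeWhile (\<lambda>y. x < y) (tl (dropWhile (\<lambda>y. y \<noteq> x) \<pi>))"

definition jacobi :: "nat list \<Rightarrow> bool" where
  "jacobi \<pi> \<longleftrightarrow> (\<forall>x \<in> set \<pi>. even (length (rho \<pi> x)))"

text \<open>For words with distinct letters: each letter is replaced by its rank, counted from 1.\<close>

definition standardization :: "nat list \<Rightarrow> nat list" where
  "standardization w = map (\<lambda>x. card {y \<in> set w. y \<le> x}) w"

text \<open>Subwords need not be consecutive here, so they are given by \<^const>\<open>subseq\<close>.\<close>

definition avoids :: "nat list \<Rightarrow> nat list \<Rightarrow> bool" where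
  "avoids \<pi> \<sigma> \<longleftrightarrow> \<not> (\<exists>w. subseq w \<pi> \<and> standardization w = \<sigma>)"

definition jacobi_count :: "nat \<Rightarrow> nat list set \<Rightarrow> nat" where
  "jacobi_count n P =
     card {\<pi> \<in> permutations_of_set {1..n}. jacobi \<pi> \<and> (\<forall>\<sigma> \<in> P. avoids \<pi> \<sigma>)}"

end

theory Submission imports Defs begin

text \<open>
  A permutation avoiding 231 and 312 is layered: it is a concatenation of decreasing runs of
  consecutive integers, each run lying below the next. The letters before the least letter \<open>m\<close>
  decrease (no 231 ending in \<open>m\<close>) and lie below the letters after \<open>m\<close> (no 312 with
  middle letter \<open>m\<close>), so \<open>m\<close> ends the first run. In a layered permutation \<open>\<rho>(x)\<close> is empty
  unless \<open>x\<close> ends a run, in which case it consists of all later letters. Hence such a permutation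
  is Jacobi iff every run but the first has even length, and summing over the length of
  the first run gives the count.
\<close>

text \<open>The lower end varies because what follows the first run is a permutation of a shorter
  interval with the same upper end. Keeping actual letters avoids any relabelling in the
  recursion.\<close>

definition layered_jacobi :: "nat \<Rightarrow> nat \<Rightarrow> nat list set" where
  "layered_jacobi m n = {\<pi> \<in> permutations_of_set {m..<n}.
     jacobi \<pi> \<and> avoids \<pi> [2, 3, 1] \<and> avoids \<pi> [3, 1, 2]}"

section \<open>Patterns as inequalities between the letters of a subword\<close>

lemma rank_less_imp_less:
  assumes "card {y \<in> set w. y \<le> a} < card {y \<in> set w. y \<le> b}"
  shows "a < (b :: nat)"
proof (rule ccontr)
  assume "\<not> a < b"
  then have "{y \<in> set w. y \<le> b} \<subseteq> {y \<in> set w. y \<le> a}" by auto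
  then have "card {y \<in> set w. y \<le> b} \<le> card {y \<in> set w. y \<le> a}"
    by (intro card_mono) auto
  with assms show False by simp
qed

lemma standardization_eq_231_iff:
  "standardization w = [2, 3, 1] \<longleftrightarrow> (\<exists>a b c. w = [a, b, c] \<and> c < a \<and> a < b)"
proof
  assume *: "standardization w = [2, 3, 1]"
  then obtain a b c where w: "w = [a, b, c]"
    unfolding standardization_def map_eq_Cons_conv by auto
  have "c < a" by (rule rank_less_imp_less[of w]) (use * w in \<open>simp add: standardization_def\<close>)
  moreover have "a < b"
    by (rule rank_less_imp_less[of w]) (use * w in \<open>simp add: standardization_def\<close>)
  ultimately show "\<exists>a b c. w = [a, b, c] \<and> c < a \<and> a < b" using w by blast
next
  assume "\<exists>a b c. w = [a, b, c] \<and> c < a \<and> a < b"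
  then obtain a b c where w: "w = [a, b, c]" "c < a" "a < b" by blast
  have "{y \<in> set w. y \<le> a} = {a, c}" "{y \<in> set w. y \<le> b} = {a, b, c}" "{y \<in> set w. y \<le> c} = {c}"
    using w by auto
  then show "standardization w = [2, 3, 1]" using w unfolding standardization_def by simp
qed

lemma standardization_eq_312_iff:
  "standardization w = [3, 1, 2] \<longleftrightarrow> (\<exists>a b c. w = [a, b, c] \<and> b < c \<and> c < a)"
proof
  assume *: "standardization w = [3, 1, 2]"
  then obtain a b c where w: "w = [a, b, c]"
    unfolding standardization_def map_eq_Cons_conv by auto
  have "b < c" by (rule rank_less_imp_less[of w]) (use * w in \<open>simp add: standardization_def\<close>)
  moreover have "c < a"
    by (rule rank_less_imp_less[of w]) (use * w in \<open>simp add: standardization_def\<close>)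
  ultimately show "\<exists>a b c. w = [a, b, c] \<and> b < c \<and> c < a" using w by blast
next
  assume "\<exists>a b c. w = [a, b, c] \<and> b < c \<and> c < a"
  then obtain a b c where w: "w = [a, b, c]" "b < c" "c < a" by blast
  have "{y \<in> set w. y \<le> a} = {a, b, c}" "{y \<in> set w. y \<le> b} = {b}" "{y \<in> set w. y \<le> c} = {b, c}"
    using w by auto
  then show "standardization w = [3, 1, 2]" using w unfolding standardization_def by simp
qed

lemma avoids_231_iff:
  "avoids \<pi> [2, 3, 1] \<longleftrightarrow> (\<forall>a b c. subseq [a, b, c] \<pi> \<longrightarrow> \<not> (c < a \<and> a < b))"
  unfolding avoids_def standardization_eq_231_iff by blast

lemma avoids_312_iff:
  "avoids \<pi> [3, 1, 2] \<longleftrightarrow> (\<forall>a b c. subseq [a, b, c] \<pi> \<longrightarrow> \<not> (b < c \<and> c < a))"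
  unfolding avoids_def standardization_eq_312_iff by blast

lemma avoids_subseq: "avoids \<pi> \<sigma> \<Longrightarrow> subseq \<tau> \<pi> \<Longrightarrow> avoids \<tau> \<sigma>"
  unfolding avoids_def using subseq_order.trans by blast

lemma subseq_imp_set_subset: "subseq xs ys \<Longrightarrow> set xs \<subseteq> set ys"
  by (metis notin_set_nthsI subseq_conv_nths subsetI)

text \<open>This links pattern avoidance, which speaks of subwords, to the order of a run: it is
  read from left to right on a known run and from right to left to recover one.\<close>

lemma sorted_wrt_iff_subseq:
  "sorted_wrt R xs \<longleftrightarrow> (\<forall>a b. subseq [a, b] xs \<longrightarrow> R a b)"
proof (induction xs)
  case (Cons x xs)
  have "subseq [a, b] (x # xs) \<longleftrightarrow> a = x \<and> b \<in> set xs \<or> subseq [a, b] xs" for a b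
    by (auto simp: subseq_singleton_left dest: subseq_Cons')
  with Cons show ?case by auto
qed simp

section \<open>The words \<open>rho\<close> and the three-letter subwords of a run followed by
  larger letters\<close>

lemma rho_append_notin: "x \<notin> set us \<Longrightarrow> rho (us @ vs) x = rho vs x"
  unfolding rho_def by (subst dropWhile_append2) auto

lemma rho_append_Cons: "x \<notin> set us \<Longrightarrow> rho (us @ x # vs) x = takeWhile (\<lambda>y. x < y) vs"
  unfolding rho_append_notin by (simp add: rho_def)

text \<open>\<open>rho\<close> looks only to the right of its letter, so a prefix sharing no letter
  with \<open>vs\<close> leaves the condition on \<open>vs\<close> unchanged.\<close>

lemma jacobi_append:
  assumes "set us \<inter> set vs = {}"
  shows "jacobi (us @ vs) \<longleftrightarrow> (\<forall>x \<in> set us. even (length (rho (us @ vs) x))) \<and> jacobi vs"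
proof -
  have "rho (us @ vs) x = rho vs x" if "x \<in> set vs" for x
    using assms that by (intro rho_append_notin) auto
  then show ?thesis unfolding jacobi_def by (simp add: ball_Un)
qed

lemma rho_run_append:
  assumes "x \<in> {m..<k}" "\<forall>y \<in> set t. k \<le> y"
  shows "rho (rev [m..<k] @ t) x = (if x = m then t else [])"
proof -
  have "[m..<k] = [m..<x] @ x # [Suc x..<k]"
    using assms by (metis atLeastLessThan_iff le_add_diff_inverse less_imp_le upt_add_eq_append upt_conv_Cons)
  then have eq: "rev [m..<k] @ t = rev [Suc x..<k] @ x # (rev [m..<x] @ t)" by simp
  have "rho (rev [m..<k] @ t) x = takeWhile (\<lambda>y. x < y) (rev [m..<x] @ t)"
    unfolding eq by (rule rho_append_Cons) simp
  also have "\<dots> = (if x = m then t else [])"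
  proof (cases "x = m")
    case True
    with assms show ?thesis by (auto simp: takeWhile_eq_all_conv)
  next
    case False
    \<comment> \<open>The letter right after \<open>x\<close> is its predecessor \<open>x'\<close>,
      which is smaller and stops \<open>takeWhile\<close> at once.\<close>
    with assms obtain x' where "x = Suc x'" "m \<le> x'" by (cases x) auto
    then show ?thesis using False by simp
  qed
  finally show ?thesis .
qed

text \<open>Outside \<open>t\<close>, the three alternatives correspond to one, two or three letters
  lying in the run. Each of them contradicts both c < a < b and b < c < a, so a forbidden pattern
  can only occur inside \<open>t\<close>.\<close>

lemma subseq3_run_append:
  assumes "subseq [a, b, c] (rev [m..<k] @ t)" and t: "\<forall>y \<in> set t. (k::nat) \<le> y"
  shows "subseq [a, b, c] t \<or> (a < b \<and> a < c) \<or> (a < c \<and> b < c) \<or> (c < b \<and> b < a)"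
proof -
  obtain u v where uv: "[a, b, c] = u @ v" "subseq u (rev [m..<k])" "subseq v t"
    using assms(1) by (auto elim: subseq_appendE)
  have u: "y < k" if "y \<in> set u" for y
    using subseq_imp_set_subset[OF uv(2)] that by auto
  have v: "k \<le> y" if "y \<in> set v" for y
    using subseq_imp_set_subset[OF uv(3)] that t by auto
  have dec: "sorted_wrt (>) (rev [m..<k])" by (simp add: sorted_wrt_rev)
  consider "u = []" | "u = [a]" "v = [b, c]" | "u = [a, b]" "v = [c]" | "u = [a, b, c]"
    using uv(1) unfolding Cons_eq_append_conv by fastforce
  then show ?thesis
  proof cases
    case 4
    have "subseq [a, b] [a, b, c]" "subseq [b, c] [a, b, c]" by auto
    then have "subseq [a, b] (rev [m..<k])" "subseq [b, c] (rev [m..<k])"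
      using uv(2) 4 subseq_order.trans by blast+
    then show ?thesis using dec unfolding sorted_wrt_iff_subseq by blast
  qed (use uv u v in force)+
qed

section \<open>Adding and splitting off the first run\<close>

lemma run_append_mem_layered_jacobi:
  assumes k: "k \<in> {m<..n}" "even (n - k)" and t: "t \<in> layered_jacobi k n"
  shows "rev [m..<k] @ t \<in> layered_jacobi m n"
proof -
  have st: "set t = {k..<n}" "distinct t" "jacobi t" "avoids t [2, 3, 1]" "avoids t [3, 1, 2]"
    using t unfolding layered_jacobi_def permutations_of_set_def by auto
  have len: "length t = n - k" using st distinct_card[of t] by simp
  have ge: "\<forall>y \<in> set t. k \<le> y" using st by simp
  have "rev [m..<k] @ t \<in> permutations_of_set {m..<n}"
    using st k unfolding permutations_of_set_def by auto
  moreover have "jacobi (rev [m..<k] @ t)"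
    by (subst jacobi_append) (use st k len ge in \<open>auto simp: rho_run_append\<close>)
  moreover have "avoids (rev [m..<k] @ t) [2, 3, 1]"
    using st(4) subseq3_run_append[OF _ ge] unfolding avoids_231_iff by (metis order.asym)
  moreover have "avoids (rev [m..<k] @ t) [3, 1, 2]"
    using st(5) subseq3_run_append[OF _ ge] unfolding avoids_312_iff by (metis order.asym)
  ultimately show ?thesis unfolding layered_jacobi_def by blast
qed

lemma layered_jacobi_first_run:
  assumes "m < n" and \<pi>: "\<pi> \<in> layered_jacobi m n"
  obtains k t where "k \<in> {m<..n}" "even (n - k)" "t \<in> layered_jacobi k n" "\<pi> = rev [m..<k] @ t"
proof -
  have s: "set \<pi> = {m..<n}" "distinct \<pi>" "jacobi \<pi>" "avoids \<pi> [2, 3, 1]" "avoids \<pi> [3, 1, 2]"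
    using \<pi> unfolding layered_jacobi_def permutations_of_set_def by auto
  obtain xs t where xt: "\<pi> = xs @ m # t"
    using s \<open>m < n\<close> split_list[of m \<pi>] by auto
  have gt: "m < y" if "y \<in> set xs \<union> set t" for y
  proof -
    have "y \<in> set \<pi>" "y \<noteq> m" using that s(2) xt by auto
    then show ?thesis using s(1) by auto
  qed
  have less: "x < y" if "x \<in> set xs" "y \<in> set t" for x y
  proof -
    have "subseq ([x] @ [m] @ [y]) (xs @ [m] @ t)"
      using that by (intro list_emb_append_mono) (auto simp: subseq_singleton_left)
    then have "\<not> (m < y \<and> y < x)" using s(5) xt unfolding avoids_312_iff by simp
    moreover have "x \<noteq> y" using that s(2) xt by auto
    ultimately show ?thesis using gt that by auto
  qed
  have dec: "b < a" if "subseq [a, b] xs" for a b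
  proof -
    have "subseq ([a, b] @ [m]) (xs @ [m] @ t)"
      using that by (intro list_emb_append_mono) auto
    then have "\<not> (m < a \<and> a < b)" using s(4) xt unfolding avoids_231_iff by simp
    moreover have "m < a" using subseq_imp_set_subset[OF that] gt by auto
    moreover have "distinct [a, b]"
      using that s(2) xt by (metis distinct_append distinct_nthsI subseq_conv_nths)
    ultimately show ?thesis by auto
  qed
  \<comment> \<open>The first run will consist of \<open>xs\<close> and \<open>m\<close>, and
    \<open>k\<close> is one past its largest letter. Inserting \<open>m\<close> keeps the maximum
    defined when \<open>xs\<close> is empty.\<close>
  define k where "k = Suc (Max (insert m (set xs)))"
  have AB: "insert m (set xs) \<union> set t = {m..<n}" using s xt by auto
  have A: "insert m (set xs) = {m..<k}"
  proof
    show "insert m (set xs) \<subseteq> {m..<k}"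
      using AB unfolding k_def by (auto simp: less_Suc_eq_le less_imp_le gt)
    \<comment> \<open>There are no gaps: a letter of \<open>t\<close> exceeds \<open>m\<close> and
      every letter of \<open>xs\<close>, hence \<open>M\<close>, so a value up to \<open>M\<close>
      cannot lie in \<open>t\<close>.\<close>
    show "{m..<k} \<subseteq> insert m (set xs)"
    proof
      fix y assume y: "y \<in> {m..<k}"
      define M where "M = Max (insert m (set xs))"
      have M: "M \<in> insert m (set xs)" unfolding M_def by (intro Max_in) auto
      have yM: "y \<le> M" using y unfolding k_def M_def[symmetric] by simp
      have "M \<in> {m..<n}" using M AB by blast
      then have "y \<in> insert m (set xs) \<union> set t" unfolding AB using y yM by simp
      moreover have "y \<notin> set t"
      proof
        assume "y \<in> set t"
        then have "M < y" using M less[of M y] gt[of y] by blast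
        then show False using yM by simp
      qed
      ultimately show "y \<in> insert m (set xs)" by blast
    qed
  qed
  have B: "set t = {k..<n}"
  proof -
    have "insert m (set xs) \<inter> set t = {}" using s(2) xt by auto
    then have "set t = {m..<n} - {m..<k}" using AB A by blast
    moreover have "m < k" using A by auto
    ultimately show ?thesis by auto
  qed
  have k: "k \<in> {m<..n}"
  proof -
    have "m < k" using A by auto
    then have "k - 1 \<in> {m..<k}" by auto
    then have "k - 1 \<in> {m..<n}" using A AB by blast
    then show ?thesis using \<open>m < k\<close> by auto
  qed
  have run: "xs @ [m] = rev [m..<k]"
  proof -
    have "sorted_wrt (>) xs" using dec unfolding sorted_wrt_iff_subseq by blast
    then have "sorted_wrt (>) (xs @ [m])" using gt by (simp add: sorted_wrt_append)
    then have "sorted_wrt (<) (rev (xs @ [m]))" by (simp only: sorted_wrt_rev)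
    \<comment> \<open>A strictly increasing list is determined by its set, here the interval found
      in \<open>A\<close>.\<close>
    then have "rev (xs @ [m]) = [m..<k]"
      by (intro strict_sorted_equal) (use A in auto)
    then show ?thesis by (metis rev_rev_ident)
  qed
  have eq: "\<pi> = rev [m..<k] @ t" using xt run by (metis append.assoc append_Cons append_Nil)
  \<comment> \<open>Being the least letter, \<open>m\<close> sees all of \<open>t\<close>, so the
    Jacobi condition at \<open>m\<close> is exactly the parity of n - k.\<close>
  have "rho \<pi> m = t" using k B unfolding eq by (subst rho_run_append) auto
  moreover have "length t = n - k" using B s(2) xt distinct_card[of t] by simp
  moreover have "m \<in> set \<pi>" using xt by simp
  ultimately have ev: "even (n - k)" using s(3) unfolding jacobi_def by metis
  have "jacobi t" using s(3) B unfolding eq by (subst (asm) jacobi_append) auto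
  moreover have "subseq t \<pi>" unfolding eq by (intro list_emb_append2) simp
  ultimately have "t \<in> layered_jacobi k n"
    using s B xt avoids_subseq unfolding layered_jacobi_def permutations_of_set_def by auto
  with k ev eq show ?thesis using that by blast
qed

lemma layered_jacobi_eq_UN:
  assumes "m < n"
  shows "layered_jacobi m n =
    (\<Union>k \<in> {k \<in> {m<..n}. even (n - k)}. (\<lambda>t. rev [m..<k] @ t) ` layered_jacobi k n)"
proof (intro equalityI subsetI)
  fix \<pi> assume "\<pi> \<in> layered_jacobi m n"
  from layered_jacobi_first_run[OF assms this] show
    "\<pi> \<in> (\<Union>k \<in> {k \<in> {m<..n}. even (n - k)}. (\<lambda>t. rev [m..<k] @ t) ` layered_jacobi k n)"
    by blast
qed (auto intro: run_append_mem_layered_jacobi)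

section \<open>Counting by the end of the first run\<close>

lemma finite_layered_jacobi: "finite (layered_jacobi m n)"
  unfolding layered_jacobi_def by simp

lemma layered_jacobi_self: "layered_jacobi n n = {[]}"
  unfolding layered_jacobi_def avoids_231_iff avoids_312_iff by (auto simp: jacobi_def)

lemma card_layered_jacobi_rec:
  assumes "m < n"
  shows "card (layered_jacobi m n) =
    (\<Sum>k \<in> {k \<in> {m<..n}. even (n - k)}. card (layered_jacobi k n))"
proof -
  have disj: "(\<lambda>t. rev [m..<k] @ t) ` layered_jacobi k n \<inter>
      (\<lambda>t. rev [m..<l] @ t) ` layered_jacobi l n = {}"
    if "m < k" "m < l" "k \<noteq> l" for k l
  proof -
    \<comment> \<open>The first letter of the word reveals where its first run ends, so different
      \<open>k\<close> give different words.\<close>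
    have "hd (rev [m..<j] @ t) = j - 1" if "m < j" for j and t :: "nat list"
      using that by (cases j) auto
    then have "rev [m..<k] @ t \<noteq> rev [m..<l] @ t'" for t t'
      using that by (metis Suc_pred' gr_implies_not_zero gr_zeroI)
    then show ?thesis by blast
  qed
  have "card (layered_jacobi m n) = (\<Sum>k \<in> {k \<in> {m<..n}. even (n - k)}.
      card ((\<lambda>t. rev [m..<k] @ t) ` layered_jacobi k n))"
    unfolding layered_jacobi_eq_UN[OF assms]
    by (rule card_UN_disjoint) (use disj in \<open>auto simp: finite_layered_jacobi\<close>)
  also have "\<dots> = (\<Sum>k \<in> {k \<in> {m<..n}. even (n - k)}. card (layered_jacobi k n))"
    by (intro sum.cong refl card_image inj_onI) simp
  finally show ?thesis .
qed

lemma card_layered_jacobi: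
  "m < n \<Longrightarrow> card (layered_jacobi m n) = 2 ^ ((n - m - 1) div 2)"
proof (induction "n - m" arbitrary: m rule: less_induct)
  case less
  \<comment> \<open>This is the largest i with m < n - 2i, so the admissible \<open>k\<close> are
    the numbers n - 2i with i \<le> q.\<close>
  define q where "q = (n - m - 1) div 2"
  have "bij_betw (\<lambda>i. n - 2 * i) {..q} {k \<in> {m<..n}. even (n - k)}"
    by (rule bij_betw_byWitness[where f' = "\<lambda>k. (n - k) div 2"])
      (use less.prems in \<open>auto simp: q_def\<close>)
  then have "card (layered_jacobi m n) = (\<Sum>i\<le>q. card (layered_jacobi (n - 2 * i) n))"
    unfolding card_layered_jacobi_rec[OF less.prems] by (rule sum.reindex_bij_betw[symmetric])
  \<comment> \<open>The term i = 0 belongs to the empty interval, where the whole word is a single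
    run. The induction hypothesis does not cover it.\<close>
  also have "\<dots> = card (layered_jacobi n n) + (\<Sum>i<q. card (layered_jacobi (n - 2 * Suc i) n))"
    by (subst sum.atMost_shift) simp
  also have "(\<Sum>i<q. card (layered_jacobi (n - 2 * Suc i) n)) = (\<Sum>i<q. 2 ^ i)"
  proof (rule sum.cong)
    fix i assume "i \<in> {..<q}"
    then have i: "2 * Suc i < n - m" by (auto simp: q_def)
    then have "card (layered_jacobi (n - 2 * Suc i) n) = 2 ^ ((n - (n - 2 * Suc i) - 1) div 2)"
      by (intro less.hyps) auto
    \<comment> \<open>The remaining interval has 2i + 2 letters, and halving 2i + 1 rounds down to
      i.\<close>
    also have "(n - (n - 2 * Suc i) - 1) div 2 = i" using i by simp
    finally show "card (layered_jacobi (n - 2 * Suc i) n) = 2 ^ i" .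
  qed simp
  \<comment> \<open>The single empty word supplies the 1 that completes the geometric sum 1 + 2 +
    ... + 2^(q-1) to 2^q.\<close>
  also have "card (layered_jacobi n n) + (\<Sum>i<q. 2 ^ i) = 2 ^ q"
    by (induction q) (simp_all add: layered_jacobi_self)
  finally show ?case unfolding q_def .
qed

theorem theorem8p7:
  fixes n :: nat
  assumes "n \<ge> 1"
  shows "jacobi_count n {[2, 3, 1], [3, 1, 2]} = 2 ^ ((n - 1) div 2)"
proof -
  have "jacobi_count n {[2, 3, 1], [3, 1, 2]} = card (layered_jacobi 1 (Suc n))"
    unfolding jacobi_count_def layered_jacobi_def by (simp add: atLeastLessThanSuc_atLeastAtMost)
  also have "\<dots> = 2 ^ ((n - 1) div 2)" using assms by (subst card_layered_jacobi) auto
  finally show ?thesis .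
qed

end
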